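(* Let $L\ge 1$ and let $c_1,\dots,c_L$ be non-negative integers with $c_1\ge 1$ and $c_L\ge 1$. Let $\{G_n\}_{n=1}^\infty$ be a positive linear recurrence sequence, i.e. a sequence of positive integers with prescribed positive initial terms $G_1,\dots,G_L$ satisfying $G_{n+1}=c_1G_n+c_2G_{n-1}+\cdots+c_LG_{n+1-L}$, such that every integer $m\in[0,G_{n+1})$ has a unique legal decomposition $m=\sum_{i=1}^n a_iG_{n+1-i}$ (legal in the sense defined in the context). Let $S\subseteq\{G_n\}_{n=1}^\infty$ be a set with positive asymptotic density $d$, and fix $\varepsilon>0$. For $m$ chosen uniformly at random from the integers in $[0,G_{n+1})$, with legal decomposition $m=\sum_{i=1}^n a_iG_{n+1-i}$, let the proportion of summands of $m$ belonging to $S$ be $$\frac{\sum_{i\le n:\ G_{n+1-i}\in S} a_i}{\sum_{i=1}^n a_i}$$ (summands counted with multiplicity). Then, as $n\to\infty$, with probability $1+o(1)$ this proportion lies within $\varepsilon$ of $d$.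
   Context: A tuple $(a_1,\dots,a_n)$ of non-negative integers (representing the sum $\sum_{i=1}^n a_iG_{n+1-i}$) is legal if either (1) $n<L$ and $a_i=c_i$ for $1\le i\le n$; or (2) there exists $s\in\{1,\dots,L\}$ such that $a_1=c_1,\dots,a_{s-1}=c_{s-1}$, $a_s<c_s$, $a_{s+1}=\cdots=a_{s+\ell}=0$ for some $\ell\ge 0$, and the tuple $(a_{s+\ell+1},\dots,a_n)$ is either legal or empty. The legal decomposition of $m$ is the (Zeckendorf) decomposition referred to. For a set $S\subseteq\{G_n\}$, its asymptotic density is $q(S)=\lim_{n\to\infty}\frac{\#\{i\le n: G_i\in S\}}{n}$ when this limit exists. *)

theory Defs
  imports "HOL-Probability.Probability"
begin

text \<open>
  All sequences are indexed from 1: only \<open>c 1, \<dots>, c L\<close> and \<open>G 1, G 2, \<dots>\<close> are meaningful.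
  A tuple \<open>(a\<^sub>1, \<dots>, a\<^sub>n)\<close> is a list \<open>a\<close> of length \<open>n\<close>, so \<open>a\<^sub>i\<close> is \<open>a ! (i - 1)\<close>.
\<close>

inductive legal :: "nat \<Rightarrow> (nat \<Rightarrow> nat) \<Rightarrow> nat list \<Rightarrow> bool" for L :: nat and c :: "nat \<Rightarrow> nat" where
  prefix: "\<lbrakk>length a < L; \<forall>i\<in>{1..length a}. a ! (i - 1) = c i\<rbrakk> \<Longrightarrow> legal L c a"
| block: "\<lbrakk>s \<in> {1..L}; k < c s; b = [] \<or> legal L c b\<rbrakk>
    \<Longrightarrow> legal L c (map c [1..<s] @ [k] @ replicate l 0 @ b)"

definition legal_decomposition ::
    "nat \<Rightarrow> (nat \<Rightarrow> nat) \<Rightarrow> (nat \<Rightarrow> nat) \<Rightarrow> nat \<Rightarrow> nat \<Rightarrow> nat list \<Rightarrow> bool" where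
  "legal_decomposition L c G n m a \<longleftrightarrow>
     length a = n \<and> legal L c a \<and> m = (\<Sum>i=1..n. a ! (i - 1) * G (n + 1 - i))"

definition positive_linear_recurrence :: "nat \<Rightarrow> (nat \<Rightarrow> nat) \<Rightarrow> (nat \<Rightarrow> nat) \<Rightarrow> bool" where
  "positive_linear_recurrence L c G \<longleftrightarrow>
     (\<forall>n\<ge>1. G n > 0) \<and>
     (\<forall>n\<ge>L. G (n + 1) = (\<Sum>i=1..L. c i * G (n + 1 - i))) \<and>
     (\<forall>n\<ge>1. \<forall>m<G (n + 1). \<exists>!a. legal_decomposition L c G n m a)"

definition the_decomposition ::
    "nat \<Rightarrow> (nat \<Rightarrow> nat) \<Rightarrow> (nat \<Rightarrow> nat) \<Rightarrow> nat \<Rightarrow> nat \<Rightarrow> nat list" where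
  "the_decomposition L c G n m = (THE a. legal_decomposition L c G n m a)"

definition has_asymptotic_density :: "(nat \<Rightarrow> nat) \<Rightarrow> nat set \<Rightarrow> real \<Rightarrow> bool" where
  "has_asymptotic_density G S d \<longleftrightarrow>
     (\<lambda>n. real (card {i \<in> {1..n}. G i \<in> S}) / real n) \<longlonglongrightarrow> d"

definition num_summands :: "nat list \<Rightarrow> nat" where
  "num_summands a = (\<Sum>i=1..length a. a ! (i - 1))"

definition num_summands_in :: "(nat \<Rightarrow> nat) \<Rightarrow> nat set \<Rightarrow> nat list \<Rightarrow> nat" where
  "num_summands_in G S a =
     (\<Sum>i \<in> {i \<in> {1..length a}. G (length a + 1 - i) \<in> S}. a ! (i - 1))"

definition proportion_in :: "(nat \<Rightarrow> nat) \<Rightarrow> nat set \<Rightarrow> nat list \<Rightarrow> real" where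
  "proportion_in G S a = real (num_summands_in G S a) / real (num_summands a)"

text \<open>
  The proportion is \<open>0/0\<close>, hence undefined, for the decomposition of \<open>m = 0\<close>. Such an \<open>m\<close> is not
  counted as a violation. It has probability \<open>1 / G (n + 1)\<close>, which tends to 0 unless
  \<open>L = 1\<close> and \<open>c 1 = 1\<close>; in that case \<open>G\<close> is constantly 1 and \<open>m = 0\<close> is the only outcome.
\<close>
definition proportion_within :: "(nat \<Rightarrow> nat) \<Rightarrow> nat set \<Rightarrow> real \<Rightarrow> real \<Rightarrow> nat list \<Rightarrow> bool" where
  "proportion_within G S d \<epsilon> a \<longleftrightarrow>
     (num_summands a \<noteq> 0 \<longrightarrow> \<bar>proportion_in G S a - d\<bar> < \<epsilon>)"

end

theory Submission
  imports Defs
begin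

text \<open>
  Legal words are the paths, started in state \<open>0\<close>, of an automaton whose state \<open>r < L\<close> counts the
  coefficients \<open>c 1, \<dots>, c r\<close> matched so far. Let \<open>x\<close> be the positive root of
  \<open>c 1 * x + \<dots> + c L * x ^ L = 1\<close>. Weighting the paths by \<open>x\<close> and by the harmonic function
  \<open>h r = c (r + 1) * x + \<dots> + c L * x ^ (L - r)\<close> (a Doob transform) turns the automaton into an
  aperiodic Markov chain in which every legal word of length \<open>n\<close> has probability at least a constant
  times \<open>x ^ n\<close>. As \<open>G (n + 1)\<close> is at least a constant times \<open>x ^ (- n)\<close>, an event that is rare for
  the chain is also rare for uniform \<open>m\<close>.

  By a Doeblin condition the expected digit converges to a constant \<open>\<mu>\<close> with summable error, uniformly
  in the starting state. Hence, for bounded weights \<open>w\<close>, the sum of \<open>w i * (digit i - \<mu>)\<close> has bounded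
  conditional means and its martingale differences are bounded, so its second moment is \<open>O(n)\<close>.
  Chebyshev's inequality with \<open>w = 1\<close> and with \<open>w = indicator - d\<close> gives the theorem. The case
  \<open>L = 1\<close>, \<open>c 1 = 1\<close>, where \<open>\<mu> = 0\<close>, is vacuous because all digits vanish.
\<close>

section \<open>Legal words as runs of an automaton\<close>

text \<open>\<open>accepts L c r b\<close>: the word \<open>b\<close> can follow the partial block \<open>c 1, \<dots>, c r\<close>.\<close>

fun accepts :: "nat \<Rightarrow> (nat \<Rightarrow> nat) \<Rightarrow> nat \<Rightarrow> nat list \<Rightarrow> bool" where
  "accepts L c r [] \<longleftrightarrow> True"
| "accepts L c r (k # b) \<longleftrightarrow>
     k < c (Suc r) \<and> accepts L c 0 b \<or> k = c (Suc r) \<and> Suc r < L \<and> accepts L c (Suc r) b"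

lemma accepts_prefix:
  assumes "r + length a < L" "\<forall>i < length a. a ! i = c (r + Suc i)"
  shows "accepts L c r a"
  using assms
proof (induction a arbitrary: r)
  case (Cons k b)
  have "\<forall>i < length b. b ! i = c (Suc r + Suc i)"
    using Cons.prems(2) by (metis Suc_less_eq add_Suc_shift length_Cons nth_Cons_Suc)
  moreover have "k = c (Suc r)" using Cons.prems(2) by (auto dest: spec[of _ 0])
  ultimately show ?case using Cons.IH[of "Suc r"] Cons.prems(1) by simp
qed simp

text \<open>Stated for every \<open>r < s\<close>, so that the induction on \<open>s - r\<close> can
  start in the middle of a block.\<close>

lemma accepts_block:
  assumes "r < s" "s \<le> L" "k < c s" "accepts L c 0 b"
  shows "accepts L c r (map c [Suc r..<s] @ k # b)"
  using assms(1)
proof (induction "s - r" arbitrary: r)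
  case (Suc d)
  show ?case
  proof (cases "Suc r = s")
    case True
    then show ?thesis using assms by simp
  next
    case False
    then have "Suc r < s" using Suc.prems by simp
    then show ?thesis using Suc.hyps(1)[of "Suc r"] Suc.hyps(2) assms(2)
      by (simp add: upt_conv_Cons)
  qed
qed simp

text \<open>Since \<open>0 < c 1\<close>, each digit 0 is a complete block of its own and keeps the
  automaton in state 0.\<close>

lemma accepts_replicate_zero:
  assumes "c 1 \<ge> 1" "accepts L c 0 b"
  shows "accepts L c 0 (replicate l 0 @ b)"
  using assms by (induction l) auto

text \<open>Each rule of \<open>legal\<close> describes a run of the automaton; upper bounds for the
  number of accepted words thus apply to legal words.\<close>

lemma legal_accepts:
  assumes "legal L c a" "c 1 \<ge> 1"
  shows "accepts L c 0 a"
  using assms(1)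
proof induction
  case (prefix a)
  have "a ! i = c (Suc i)" if "i < length a" for i
    using bspec[OF prefix(2), of "Suc i"] that by simp
  then show ?case using prefix(1) by (intro accepts_prefix) auto
next
  case (block s k b l)
  then have "accepts L c 0 b" by auto
  then show ?case
    using accepts_block[of 0 s L k c "replicate l 0 @ b"] accepts_replicate_zero[of c L b l] assms(2) block
    by simp
qed

section \<open>Weighted digit sums\<close>

text \<open>Weights are indexed from the right, as in \<open>a\<^sub>i * G (n + 1 - i)\<close>: the last digit has weight \<open>w 1\<close>.\<close>

primrec weighted_sum :: "(nat \<Rightarrow> real) \<Rightarrow> nat list \<Rightarrow> real" where
  "weighted_sum w [] = 0"
| "weighted_sum w (k # b) = w (Suc (length b)) * real k + weighted_sum w b"

lemma weighted_sum_conv_sum: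
  "weighted_sum w a = (\<Sum>i=1..length a. w (length a + 1 - i) * real (a ! (i - 1)))"
proof (induction a)
  case (Cons k b)
  have "(\<Sum>i=1..length (k # b). w (length (k # b) + 1 - i) * real ((k # b) ! (i - 1)))
      = w (Suc (length b)) * real k
        + (\<Sum>i=Suc 1..Suc (length b). w (Suc (Suc (length b)) - i) * real ((k # b) ! (i - 1)))"
    by (subst sum.atLeast_Suc_atMost) auto
  also have "(\<Sum>i=Suc 1..Suc (length b). w (Suc (Suc (length b)) - i) * real ((k # b) ! (i - 1)))
      = (\<Sum>i=1..length b. w (length b + 1 - i) * real (b ! (i - 1)))"
    by (subst sum.shift_bounds_cl_Suc_ivl) (auto intro!: sum.cong simp: nth_Cons')
  finally show ?case using Cons by simp
qed simp

lemma weighted_sum_one: "weighted_sum (\<lambda>_. 1) a = real (num_summands a)"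
  by (simp add: weighted_sum_conv_sum num_summands_def)

text \<open>Divided by \<open>num_summands a\<close>, this is the deviation of the proportion from
  \<open>d\<close>, so the ratio is controlled by two linear statistics.\<close>

lemma weighted_sum_indicator:
  "weighted_sum (\<lambda>j. of_bool (G j \<in> S) - d) a
     = real (num_summands_in G S a) - d * real (num_summands a)"
proof -
  have "real (num_summands_in G S a)
      = (\<Sum>i=1..length a. of_bool (G (length a + 1 - i) \<in> S) * real (a ! (i - 1)))"
    unfolding num_summands_in_def of_nat_sum
    by (intro sum.mono_neutral_cong_left) auto
  then show ?thesis
    by (simp add: weighted_sum_conv_sum num_summands_def left_diff_distrib sum_subtractf
        sum_distrib_left)
qed

section \<open>The Doob-transformed Markov chain\<close>

locale digit_chain =
  fixes L :: nat and c :: "nat \<Rightarrow> nat" and x :: real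
  assumes L: "L \<ge> 1" and c1: "c 1 \<ge> 1" and cL: "c L \<ge> 1"
    and x: "x > 0" and root: "(\<Sum>i=1..L. real (c i) * x ^ i) = 1"
begin

definition h :: "nat \<Rightarrow> real" where
  "h r = (\<Sum>s=Suc r..L. real (c s) * x ^ (s - r))"

lemma h_0: "h 0 = 1"
  using root by (simp add: h_def)

lemma h_L: "h L = 0"
  by (simp add: h_def)

text \<open>Harmonicity: from \<open>r\<close>, \<open>c (Suc r)\<close> digits lead to state 0,
  where \<open>h\<close> is 1, and one leads to \<open>Suc r\<close>; each digit costs a factor
  \<open>x\<close>.\<close>

lemma h_rec: "r < L \<Longrightarrow> h r = x * (real (c (Suc r)) + h (Suc r))"
proof -
  assume r: "r < L"
  have "h r = real (c (Suc r)) * x + (\<Sum>s=Suc (Suc r)..L. real (c s) * x ^ (s - r))"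
    unfolding h_def using r by (subst sum.atLeast_Suc_atMost) auto
  also have "(\<Sum>s=Suc (Suc r)..L. real (c s) * x ^ (s - r))
      = (\<Sum>s=Suc (Suc r)..L. x * (real (c s) * x ^ (s - Suc r)))"
    by (intro sum.cong refl) (simp add: Suc_diff_Suc flip: power_Suc)
  finally show ?thesis
    by (simp add: h_def sum_distrib_left algebra_simps)
qed

lemma h_nonneg: "h r \<ge> 0"
  unfolding h_def using x by (intro sum_nonneg) auto

lemma h_pos: "r < L \<Longrightarrow> h r > 0"
  unfolding h_def using x cL L by (intro sum_pos2[of _ L]) auto

text \<open>The expectation of \<open>\<phi>\<close> (next digit) (next state) when the chain is in state \<open>r\<close>. At \<open>r = L - 1\<close> the
  meaningless state \<open>L\<close> has probability \<open>0\<close> because \<open>h L = 0\<close>.\<close>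

definition step :: "nat \<Rightarrow> (nat \<Rightarrow> nat \<Rightarrow> real) \<Rightarrow> real" where
  "step r \<phi> = x / h r * ((\<Sum>k<c (Suc r). \<phi> k 0) + h (Suc r) * \<phi> (c (Suc r)) (Suc r))"

lemma step_mono:
  assumes "r < L" "\<And>k s. k \<le> c (Suc r) \<Longrightarrow> s < L \<Longrightarrow> \<phi> k s \<le> \<psi> k s"
  shows "step r \<phi> \<le> step r \<psi>"
proof -
  have "h (Suc r) * \<phi> (c (Suc r)) (Suc r) \<le> h (Suc r) * \<psi> (c (Suc r)) (Suc r)"
  \<comment> \<open>A move to the meaningless state \<open>L\<close> carries the factor
    \<open>h L = 0\<close>, so comparing the functions on true states is enough.\<close>
  proof (cases "Suc r = L")
    case False
    then show ?thesis using assms h_nonneg by (intro mult_left_mono) auto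
  qed (simp add: h_L)
  moreover have "(\<Sum>k<c (Suc r). \<phi> k 0) \<le> (\<Sum>k<c (Suc r). \<psi> k 0)"
    using assms L by (intro sum_mono) auto
  ultimately show ?thesis
    unfolding step_def using x h_pos[OF assms(1)] by (intro mult_left_mono) auto
qed

lemma step_cong:
  assumes "r < L" "\<And>k s. k \<le> c (Suc r) \<Longrightarrow> s < L \<Longrightarrow> \<phi> k s = \<psi> k s"
  shows "step r \<phi> = step r \<psi>"
  using step_mono[of r \<phi> \<psi>] step_mono[of r \<psi> \<phi>] assms by force

lemma step_add: "step r (\<lambda>k s. \<phi> k s + \<psi> k s) = step r \<phi> + step r \<psi>"
  by (simp add: step_def sum.distrib algebra_simps)

lemma step_cmult: "step r (\<lambda>k s. t * \<phi> k s) = t * step r \<phi>"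
  by (simp add: step_def sum_distrib_left algebra_simps)

text \<open>By \<open>h_rec\<close> the transition probabilities out of \<open>r\<close> sum to
  1.\<close>

lemma step_const: "r < L \<Longrightarrow> step r (\<lambda>k s. t) = t"
  using h_rec[of r] h_pos[of r] x by (simp add: step_def field_simps)

lemma step_sum: "step r (\<lambda>k s. \<Sum>i\<in>A. \<phi> i k s) = (\<Sum>i\<in>A. step r (\<phi> i))"
proof (induction A rule: infinite_finite_induct)
  case (insert i A)
  then show ?case by (simp add: step_add)
qed (simp_all add: step_def)

text \<open>Expectation over the first \<open>n\<close> digits of the chain started in
  \<open>r\<close>, built by conditioning on the first step instead of constructing a path
  measure.\<close>

primrec expect :: "nat \<Rightarrow> nat \<Rightarrow> (nat list \<Rightarrow> real) \<Rightarrow> real" where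
  "expect 0 r f = f []"
| "expect (Suc n) r f = step r (\<lambda>k s. expect n s (\<lambda>b. f (k # b)))"

lemma expect_mono:
  assumes "r < L" "\<And>a. length a = n \<Longrightarrow> f a \<le> f' a"
  shows "expect n r f \<le> expect n r f'"
  using assms by (induction n arbitrary: r f f') (auto intro!: step_mono)

lemma expect_cong:
  assumes "r < L" "\<And>a. length a = n \<Longrightarrow> f a = f' a"
  shows "expect n r f = expect n r f'"
  using expect_mono[of r n f f'] expect_mono[of r n f' f] assms by force

lemma expect_add: "expect n r (\<lambda>a. f a + f' a) = expect n r f + expect n r f'"
  by (induction n arbitrary: r f f') (simp_all add: step_add)

lemma expect_cmult: "expect n r (\<lambda>a. t * f a) = t * expect n r f"
  by (induction n arbitrary: r f) (simp_all add: step_cmult)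

lemma expect_const: "r < L \<Longrightarrow> expect n r (\<lambda>a. t) = t"
proof (induction n arbitrary: r)
  case (Suc n)
  then have "step r (\<lambda>k s. expect n s (\<lambda>b. t)) = step r (\<lambda>k s. t)"
    by (intro step_cong) auto
  then show ?case using Suc step_const by simp
qed simp

section \<open>Convergence of the chain to its stationary mean\<close>

definition trans_op :: "(nat \<Rightarrow> real) \<Rightarrow> nat \<Rightarrow> real" where
  "trans_op f r = step r (\<lambda>k s. f s)"

text \<open>\<open>(trans_op ^^ n) mean_digit r\<close> is the expectation of digit number
  \<open>n + 1\<close> from state \<open>r\<close>.\<close>

definition mean_digit :: "nat \<Rightarrow> real" where
  "mean_digit r = step r (\<lambda>k s. real k)"

lemma trans_op_iter_Suc: "(trans_op ^^ Suc n) f r = step r (\<lambda>k s. (trans_op ^^ n) f s)"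
  by (simp add: trans_op_def)

lemma trans_op_iter_bounds:
  assumes "\<And>s. s < L \<Longrightarrow> lo \<le> f s \<and> f s \<le> hi" "r < L"
  shows "lo \<le> (trans_op ^^ n) f r \<and> (trans_op ^^ n) f r \<le> hi"
  using assms(2)
proof (induction n arbitrary: r)
  case (Suc n)
  have "step r (\<lambda>k s. lo) \<le> step r (\<lambda>k s. (trans_op ^^ n) f s)"
    using Suc by (intro step_mono) auto
  moreover have "step r (\<lambda>k s. (trans_op ^^ n) f s) \<le> step r (\<lambda>k s. hi)"
    using Suc by (intro step_mono) auto
  ultimately show ?case using step_const Suc.prems unfolding trans_op_iter_Suc by simp
qed (use assms in auto)

lemma trans_op_iter_affine:
  assumes "r < L"
  shows "(trans_op ^^ n) (\<lambda>s. t * f s + u) r = t * (trans_op ^^ n) f r + u"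
  using assms
proof (induction n arbitrary: r)
  case (Suc n)
  then have "step r (\<lambda>k s. (trans_op ^^ n) (\<lambda>s. t * f s + u) s)
      = step r (\<lambda>k s. t * (trans_op ^^ n) f s + u)"
    by (intro step_cong) auto
  then show ?case
    using Suc.prems unfolding trans_op_iter_Suc by (simp add: step_add step_cmult step_const)
qed simp

lemma trans_op_eq:
  "trans_op f r = x * c (Suc r) / h r * f 0 + x * h (Suc r) / h r * f (Suc r)"
  by (simp add: trans_op_def step_def algebra_simps add_divide_distrib)

text \<open>From any state the chain can climb to state \<open>L - 1\<close>, where it is forced back to \<open>0\<close>, and
  \<open>c 1 \<ge> 1\<close> allows it to wait at \<open>0\<close>; hence the minorisation holds at a common time.\<close>

lemma minorisation_state:
  assumes "r < L" "L \<le> r + n"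
  shows "\<exists>\<delta>>0. \<forall>f. (\<forall>s<L. 0 \<le> f s) \<longrightarrow> \<delta> * f 0 \<le> (trans_op ^^ n) f r"
  using assms
proof (induction n arbitrary: r)
  case (Suc n)
  note hr = h_pos[OF Suc.prems(1)]
  have stay: "\<exists>\<delta>>0. \<forall>f. (\<forall>s<L. 0 \<le> f s) \<longrightarrow> \<delta> * f 0 \<le> (trans_op ^^ m) f 0" for m
  proof (induction m)
    case 0
    show ?case by (intro exI[of _ 1]) auto
  next
    case (Suc m)
    then obtain \<delta> where \<delta>: "\<delta> > 0"
      "\<And>f. (\<forall>s<L. 0 \<le> f s) \<Longrightarrow> \<delta> * f 0 \<le> (trans_op ^^ m) f 0" by blast
    show ?case
    proof (intro exI[of _ "x * c 1 * \<delta>"] conjI allI impI)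
      fix f :: "nat \<Rightarrow> real" assume f: "\<forall>s<L. 0 \<le> f s"
      have "0 \<le> h 1 * (trans_op ^^ m) f 1"
      proof (cases "L = 1")
        case False
        then have "0 \<le> (trans_op ^^ m) f 1"
          \<comment> \<open>Only the lower bound 0 matters; the maximum of \<open>f\<close> fills
            the place of the upper bound.\<close>
          using trans_op_iter_bounds[of 0 f "Max (f ` {..<L})" 1 m] f L by auto
        then show ?thesis using h_nonneg by simp
      qed (use h_L in simp)
      then have "x * c 1 * (trans_op ^^ m) f 0 \<le> (trans_op ^^ Suc m) f 0"
        using L x by (simp add: trans_op_eq h_0 algebra_simps)
      moreover have "x * c 1 * (\<delta> * f 0) \<le> x * c 1 * (trans_op ^^ m) f 0"
        using \<delta>(2)[OF f] x by (intro mult_left_mono) auto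
      ultimately show "x * c 1 * \<delta> * f 0 \<le> (trans_op ^^ Suc m) f 0" by (simp add: mult.assoc)
    qed (use x c1 \<delta> in auto)
  qed
  show ?case
  proof (cases "Suc r = L")
    case True
    \<comment> \<open>Here \<open>h r = x * c L\<close>, so the return to state 0 has probability
      1.\<close>
    then have "(trans_op ^^ Suc n) f r = (trans_op ^^ n) f 0" for f
      using Suc.prems h_rec[of r] hr x cL by (simp add: trans_op_eq h_L)
    then show ?thesis using stay by simp
  next
    case False
    then have r: "Suc r < L" using Suc.prems by simp
    then obtain \<delta> where \<delta>: "\<delta> > 0"
      "\<And>f. (\<forall>s<L. 0 \<le> f s) \<Longrightarrow> \<delta> * f 0 \<le> (trans_op ^^ n) f (Suc r)"
      using Suc.IH[of "Suc r"] Suc.prems by auto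
    show ?thesis
    proof (intro exI[of _ "x * h (Suc r) / h r * \<delta>"] conjI allI impI)
      fix f :: "nat \<Rightarrow> real" assume f: "\<forall>s<L. 0 \<le> f s"
      have "0 \<le> (trans_op ^^ n) f 0"
        using trans_op_iter_bounds[of 0 f "Max (f ` {..<L})" 0 n] f L by auto
      then have "x * h (Suc r) / h r * (trans_op ^^ n) f (Suc r) \<le> (trans_op ^^ Suc n) f r"
        using Suc.prems x hr by (simp add: trans_op_eq)
      moreover have "x * h (Suc r) / h r * (\<delta> * f 0)
          \<le> x * h (Suc r) / h r * (trans_op ^^ n) f (Suc r)"
        using \<delta>(2)[OF f] x hr h_nonneg by (intro mult_left_mono) auto
      ultimately show "x * h (Suc r) / h r * \<delta> * f 0 \<le> (trans_op ^^ Suc n) f r"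
        by (simp add: mult.assoc)
    qed (use x h_pos r hr \<delta> in auto)
  qed
qed simp

text \<open>Doeblin's condition at time \<open>L\<close>, late enough for every starting state;
  there are finitely many states, so the smallest constant serves all.\<close>

lemma minorisation:
  obtains \<delta> where "\<delta> > 0"
    "\<And>f r. (\<And>s. s < L \<Longrightarrow> 0 \<le> f s) \<Longrightarrow> r < L \<Longrightarrow> \<delta> * f 0 \<le> (trans_op ^^ L) f r"
proof -
  have "\<forall>r\<in>{..<L}. \<exists>\<delta>>0. \<forall>f. (\<forall>s<L. 0 \<le> f s) \<longrightarrow> \<delta> * f 0 \<le> (trans_op ^^ L) f r"
    using minorisation_state by auto
  then obtain \<delta> where \<delta>: "\<And>r. r < L \<Longrightarrow> \<delta> r > 0"
    "\<And>r f. r < L \<Longrightarrow> (\<forall>s<L. 0 \<le> f s) \<Longrightarrow> \<delta> r * f 0 \<le> (trans_op ^^ L) f r"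
    by (auto dest!: bchoice)
  define m where "m = Min (\<delta> ` {..<L})"
  have ne: "{..<L} \<noteq> {}" using L by (auto simp: lessThan_empty_iff)
  have "m > 0" unfolding m_def using \<delta>(1) ne by (subst Min_gr_iff) auto
  moreover have "m * f 0 \<le> (trans_op ^^ L) f r" if "\<And>s. s < L \<Longrightarrow> 0 \<le> f s" "r < L" for f r
  proof -
    have "m \<le> \<delta> r" unfolding m_def using that by (intro Min_le) auto
    then have "m * f 0 \<le> \<delta> r * f 0" using that L by (intro mult_right_mono) auto
    then show ?thesis using \<delta>(2)[of r f] that by auto
  qed
  ultimately show ?thesis using that by blast
qed

definition lower :: "(nat \<Rightarrow> real) \<Rightarrow> real" where "lower f = Min (f ` {..<L})"
definition upper :: "(nat \<Rightarrow> real) \<Rightarrow> real" where "upper f = Max (f ` {..<L})"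

lemma lower_upper: "r < L \<Longrightarrow> lower f \<le> f r \<and> f r \<le> upper f"
  by (auto simp: lower_def upper_def)

lemma lower_greatest: "(\<And>r. r < L \<Longrightarrow> t \<le> f r) \<Longrightarrow> t \<le> lower f"
  unfolding lower_def using L by (subst Min_ge_iff) (auto simp: lessThan_empty_iff)

lemma upper_least: "(\<And>r. r < L \<Longrightarrow> f r \<le> t) \<Longrightarrow> upper f \<le> t"
  unfolding upper_def using L by (subst Max_le_iff) (auto simp: lessThan_empty_iff)

lemma lower_upper_iter:
  "lower f \<le> lower ((trans_op ^^ n) f)" "upper ((trans_op ^^ n) f) \<le> upper f"
  using trans_op_iter_bounds[of "lower f" f "upper f" _ n] lower_upper
  by (auto intro!: lower_greatest upper_least)

text \<open>The minorisation is applied to the nonnegative functions \<open>f - lower f\<close> and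
  \<open>upper f - f\<close>; in the difference of the two bounds \<open>f 0\<close>
  cancels.\<close>

lemma oscillation_contracts:
  assumes "\<And>f r. (\<And>s. s < L \<Longrightarrow> 0 \<le> f s) \<Longrightarrow> r < L \<Longrightarrow> \<delta> * f 0 \<le> (trans_op ^^ L) f r"
  shows "upper ((trans_op ^^ L) f) - lower ((trans_op ^^ L) f) \<le> (1 - \<delta>) * (upper f - lower f)"
proof -
  have "lower f + \<delta> * (f 0 - lower f) \<le> lower ((trans_op ^^ L) f)"
  proof (rule lower_greatest)
    fix r assume r: "r < L"
    \<comment> \<open>The redundant factor 1 gives the shape that
      \<open>trans_op_iter_affine\<close> rewrites.\<close>
    have "\<delta> * (1 * f 0 + (- lower f)) \<le> (trans_op ^^ L) (\<lambda>s. 1 * f s + (- lower f)) r"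
      using lower_upper[of _ f] r by (intro assms) auto
    then show "lower f + \<delta> * (f 0 - lower f) \<le> (trans_op ^^ L) f r"
      unfolding trans_op_iter_affine[OF r] by simp
  qed
  moreover have "upper ((trans_op ^^ L) f) \<le> upper f - \<delta> * (upper f - f 0)"
  proof (rule upper_least)
    fix r assume r: "r < L"
    have "\<delta> * ((-1) * f 0 + upper f) \<le> (trans_op ^^ L) (\<lambda>s. (-1) * f s + upper f) r"
      using lower_upper[of _ f] r by (intro assms) auto
    then show "(trans_op ^^ L) f r \<le> upper f - \<delta> * (upper f - f 0)"
      unfolding trans_op_iter_affine[OF r] by simp
  qed
  ultimately show ?thesis by (simp add: algebra_simps)
qed

text \<open>Minima increase and maxima decrease along the iterates, enclosing \<mu>; the error
  \<open>e\<close> is their gap, which contracts every \<open>L\<close> steps. The last conclusion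
  later yields \<mu> > 0.\<close>

lemma iterates_converge:
  obtains \<mu> e B where "\<And>k r. r < L \<Longrightarrow> \<bar>(trans_op ^^ k) f r - \<mu>\<bar> \<le> e k"
    "\<And>n. (\<Sum>k<n. e k) \<le> B" "\<And>k. lower ((trans_op ^^ k) f) \<le> \<mu>"
proof -
  obtain \<delta> where \<delta>: "\<delta> > 0"
    "\<And>f r. (\<And>s. s < L \<Longrightarrow> 0 \<le> f s) \<Longrightarrow> r < L \<Longrightarrow> \<delta> * f 0 \<le> (trans_op ^^ L) f r"
    using minorisation by blast
  define lo where "lo k = lower ((trans_op ^^ k) f)" for k
  define hi where "hi k = upper ((trans_op ^^ k) f)" for k
  have lo_mono: "lo k \<le> lo (k + j)" and hi_mono: "hi (k + j) \<le> hi k" for k j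
    using lower_upper_iter[where f = "(trans_op ^^ k) f" and n = j] unfolding lo_def hi_def
    by (simp_all add: funpow_add add.commute[of k])
  have le: "lo k \<le> hi k" for k
    using lower_upper[of 0 "(trans_op ^^ k) f"] L unfolding lo_def hi_def by auto
  have cross: "lo i \<le> hi j" for i j
  proof -
    have "lo i \<le> lo (i + j)" "hi (j + i) \<le> hi j" using lo_mono hi_mono by auto
    then show ?thesis using le[of "i + j"] by (simp add: add.commute)
  qed
  define \<mu> where "\<mu> = (SUP i. lo i)"
  have lo_\<mu>: "lo k \<le> \<mu>" for k
    unfolding \<mu>_def using cross by (intro cSUP_upper) (auto intro!: bdd_aboveI)
  have \<mu>_hi: "\<mu> \<le> hi k" for k
    unfolding \<mu>_def using cross by (intro cSUP_least) auto
  define e where "e k = hi k - lo k" for k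
  have e_nonneg: "e k \<ge> 0" for k using le by (simp add: e_def)
  have e_le: "e k \<le> e 0" for k using lo_mono[of 0 k] hi_mono[of 0 k] by (simp add: e_def)
  have contr: "e (L + k) \<le> (1 - \<delta>) * e k" for k
    using oscillation_contracts[OF \<delta>(2), where f = "(trans_op ^^ k) f"] unfolding e_def lo_def hi_def
    by (simp add: funpow_add)
  \<comment> \<open>For the partial sum \<open>s\<close>, shifting the index by \<open>L\<close>
    gives \<open>s \<le> L * e 0 + (1 - \<delta>) * s\<close>, which is solved for
    \<open>s\<close>.\<close>
  have "(\<Sum>k<n. e k) \<le> L * e 0 / \<delta>" for n
  proof -
    have "(\<Sum>k<n. e k) \<le> (\<Sum>k<L + n. e k)"
      using e_nonneg by (intro sum_mono2) auto
    also have "\<dots> = (\<Sum>k<L. e k) + (\<Sum>k<n. e (L + k))"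
      by (induction n) auto
    also have "\<dots> \<le> (\<Sum>k<L. e 0) + (\<Sum>k<n. (1 - \<delta>) * e k)"
      by (intro add_mono sum_mono contr e_le)
    also have "\<dots> = L * e 0 + (1 - \<delta>) * (\<Sum>k<n. e k)" by (simp add: sum_distrib_left)
    finally have "\<delta> * (\<Sum>k<n. e k) \<le> L * e 0" by (simp add: algebra_simps)
    then show ?thesis using \<delta>(1) by (simp add: field_simps)
  qed
  moreover have "\<bar>(trans_op ^^ k) f r - \<mu>\<bar> \<le> e k" if "r < L" for k r
    using lower_upper[OF that, of "(trans_op ^^ k) f"] lo_\<mu>[of k] \<mu>_hi[of k]
    unfolding e_def lo_def hi_def by linarith
  ultimately show ?thesis using that[of \<mu> e] lo_\<mu> unfolding lo_def by blast
qed

section \<open>Second moments of weighted digit sums\<close>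

text \<open>Summability of \<open>e\<close> keeps the bias bounded, and conditioning on the first
  digit shows that each further digit adds at most a constant to the variance.\<close>

lemma weighted_sum_second_moment:
  assumes conv: "\<And>k r. r < L \<Longrightarrow> \<bar>(trans_op ^^ k) mean_digit r - \<mu>\<bar> \<le> e k"
    and e: "\<And>n. (\<Sum>k<n. e k) \<le> B" and w: "\<And>i. \<bar>w i\<bar> \<le> M"
  shows "\<exists>A. \<forall>n. expect n 0 (\<lambda>a. (weighted_sum w a - \<mu> * (\<Sum>i<n. w (Suc i)))\<^sup>2) \<le> A * real (Suc n)"
proof -
  define Z where "Z a = weighted_sum w a - \<mu> * (\<Sum>i<length a. w (Suc i))" for a
  \<comment> \<open>\<open>D n r\<close> is the mean of \<open>Z\<close> on words of length \<open>n\<close> from state \<open>r\<close>; subtracting it makes the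
    first-step differences centred, so that second moments add up.\<close>
  define D where "D n r = (\<Sum>i<n. w (Suc i) * ((trans_op ^^ (n - Suc i)) mean_digit r - \<mu>))" for n r
  have Z_Cons: "Z (k # b) = w (Suc (length b)) * (k - \<mu>) + Z b" for k b
    by (simp add: Z_def algebra_simps)
  have M: "M \<ge> 0" using w[of 0] by linarith
  have D_bound: "\<bar>D n r\<bar> \<le> M * B" if "r < L" for n r
  proof -
    have "\<bar>D n r\<bar> \<le> (\<Sum>i<n. \<bar>w (Suc i) * ((trans_op ^^ (n - Suc i)) mean_digit r - \<mu>)\<bar>)"
      unfolding D_def by (rule sum_abs)
    \<comment> \<open>Weights count from the right: the digit of weight \<open>w (Suc i)\<close> is
      emitted after \<open>n - Suc i\<close> steps.\<close>
    also have "\<dots> \<le> (\<Sum>i<n. M * e (n - Suc i))"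
      unfolding abs_mult using w conv[OF that] M by (intro sum_mono mult_mono) auto
    also have "\<dots> = M * (\<Sum>k<n. e k)"
      unfolding sum_distrib_left[symmetric] by (simp add: sum.nat_diff_reindex)
    also have "\<dots> \<le> M * B" using e M by (intro mult_left_mono) auto
    finally show ?thesis .
  qed
  have D_Suc: "D (Suc n) r = step r (\<lambda>k s. w (Suc n) * (k - \<mu>) + D n s)" if r: "r < L" for n r
  proof -
    have lin: "step r (\<lambda>k s. t * (\<phi> k s - \<mu>)) = t * (step r \<phi> - \<mu>)" for t \<phi>
      using step_add[of r \<phi> "\<lambda>k s. - \<mu>"] step_const[OF r, of "- \<mu>"] by (simp add: step_cmult)
    have "step r (\<lambda>k s. w (Suc n) * (k - \<mu>) + D n s)
        = w (Suc n) * (mean_digit r - \<mu>)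
          + (\<Sum>i<n. w (Suc i) * ((trans_op ^^ Suc (n - Suc i)) mean_digit r - \<mu>))"
      unfolding D_def step_add step_sum lin mean_digit_def[symmetric] trans_op_iter_Suc ..
    also have "\<dots> = D (Suc n) r"
      by (simp add: D_def Suc_diff_Suc del: funpow.simps)
    finally show ?thesis ..
  qed
  have mean: "expect n r Z = D n r" if "r < L" for n r
    using that
  proof (induction n arbitrary: r)
    case (Suc n)
    have "expect (Suc n) r Z = step r (\<lambda>k s. w (Suc n) * (k - \<mu>) + D n s)"
      unfolding expect.simps
    proof (rule step_cong[OF Suc.prems])
      fix k s assume s: "s < L"
      have "expect n s (\<lambda>b. Z (k # b)) = expect n s (\<lambda>b. w (Suc n) * (k - \<mu>) + Z b)"
        using s by (intro expect_cong) (auto simp: Z_Cons)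
      then show "expect n s (\<lambda>b. Z (k # b)) = w (Suc n) * (k - \<mu>) + D n s"
        using s Suc.IH by (simp add: expect_add expect_const)
    qed
    then show ?case using D_Suc[OF Suc.prems] by simp
  qed (simp add: Z_def D_def)
  define C where "C = (\<Sum>i\<le>L. real (c i))"
  \<comment> \<open>Bounds the first-step difference \<open>t\<close> below:
    \<open>M * (C + \<bar>\<mu>\<bar>)\<close> for the digit, \<open>M * B\<close> for each of the
    two values of \<open>D\<close>.\<close>
  define K where "K = M * (C + \<bar>\<mu>\<bar>) + 2 * (M * B)"
  have second: "expect n r (\<lambda>b. (Z b - D n r)\<^sup>2) \<le> n * K\<^sup>2" if "r < L" for n r
    using that
  proof (induction n arbitrary: r)
    case (Suc n)
    note r = Suc.prems
    have "expect (Suc n) r (\<lambda>b. (Z b - D (Suc n) r)\<^sup>2) \<le> step r (\<lambda>k s. Suc n * K\<^sup>2)"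
      unfolding expect.simps
    proof (rule step_mono[OF r])
      fix k s assume k: "k \<le> c (Suc r)" and s: "s < L"
      define t where "t = w (Suc n) * (k - \<mu>) + D n s - D (Suc n) r"
      have "real (c (Suc r)) \<le> C"
        unfolding C_def using r by (intro member_le_sum) auto
      then have "\<bar>k - \<mu>\<bar> \<le> C + \<bar>\<mu>\<bar>" using k by linarith
      then have "\<bar>w (Suc n) * (k - \<mu>)\<bar> \<le> M * (C + \<bar>\<mu>\<bar>)"
        unfolding abs_mult using w M by (intro mult_mono) auto
      then have "\<bar>t\<bar> \<le> K"
        unfolding t_def K_def using D_bound[OF s, of n] D_bound[OF r, of "Suc n"] by linarith
      then have t: "t\<^sup>2 \<le> K\<^sup>2" using power_mono[of "\<bar>t\<bar>" K 2] by simp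
      \<comment> \<open>Removes the cross term when the square is expanded.\<close>
      have centred: "expect n s (\<lambda>b. Z b - D n s) = 0"
        using mean[OF s, of n] expect_add[of n s Z "\<lambda>b. - D n s"] expect_const[OF s] by simp
      have "expect n s (\<lambda>b. (Z (k # b) - D (Suc n) r)\<^sup>2)
          = expect n s (\<lambda>b. t\<^sup>2 + (2 * t * (Z b - D n s) + (Z b - D n s)\<^sup>2))"
      proof (rule expect_cong[OF s])
        fix b :: "nat list" assume "length b = n"
        then have "Z (k # b) - D (Suc n) r = t + (Z b - D n s)"
          by (simp add: Z_Cons t_def)
        then show "(Z (k # b) - D (Suc n) r)\<^sup>2
            = t\<^sup>2 + (2 * t * (Z b - D n s) + (Z b - D n s)\<^sup>2)"
          by (simp only: power2_sum ac_simps)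
      qed
      also have "\<dots> = t\<^sup>2 + expect n s (\<lambda>b. (Z b - D n s)\<^sup>2)"
        unfolding expect_add expect_cmult centred expect_const[OF s] by simp
      also have "\<dots> \<le> Suc n * K\<^sup>2" using t Suc.IH[OF s] by (simp add: algebra_simps)
      finally show "expect n s (\<lambda>b. (Z (k # b) - D (Suc n) r)\<^sup>2) \<le> Suc n * K\<^sup>2" .
    qed
    then show ?case using step_const[OF r] by simp
  qed (simp add: Z_def D_def)
  show ?thesis
  proof (intro exI[of _ "2 * K\<^sup>2 + 2 * (M * B)\<^sup>2"] allI)
    fix n
    have L0: "0 < L" using L by simp
    have "expect n 0 (\<lambda>a. (weighted_sum w a - \<mu> * (\<Sum>i<n. w (Suc i)))\<^sup>2)
        \<le> expect n 0 (\<lambda>a. 2 * (Z a - D n 0)\<^sup>2 + 2 * (M * B)\<^sup>2)"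
    proof (rule expect_mono[OF L0])
      fix a :: "nat list" assume a: "length a = n"
      have "(D n 0)\<^sup>2 \<le> (M * B)\<^sup>2" using D_bound[OF L0, of n] power_mono[of "\<bar>D n 0\<bar>" "M * B" 2] by simp
      \<comment> \<open>The two sides differ by the square of
        \<open>Z a - 2 * D n 0\<close>.\<close>
      moreover have "(Z a)\<^sup>2 \<le> 2 * (Z a - D n 0)\<^sup>2 + 2 * (D n 0)\<^sup>2"
        using zero_le_power2[of "Z a - 2 * D n 0"] by (simp add: power2_eq_square algebra_simps)
      ultimately show "(weighted_sum w a - \<mu> * (\<Sum>i<n. w (Suc i)))\<^sup>2
          \<le> 2 * (Z a - D n 0)\<^sup>2 + 2 * (M * B)\<^sup>2"
        using a by (simp add: Z_def)
    qed
    also have "\<dots> = 2 * expect n 0 (\<lambda>a. (Z a - D n 0)\<^sup>2) + 2 * (M * B)\<^sup>2"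
      unfolding expect_add expect_cmult expect_const[OF L0] ..
    also have "\<dots> \<le> 2 * (n * K\<^sup>2) + 2 * (M * B)\<^sup>2" using second[OF L0, of n] by simp
    also have "\<dots> \<le> (2 * K\<^sup>2 + 2 * (M * B)\<^sup>2) * Suc n"
      by (simp add: algebra_simps)
    finally show "expect n 0 (\<lambda>a. (weighted_sum w a - \<mu> * (\<Sum>i<n. w (Suc i)))\<^sup>2)
        \<le> (2 * K\<^sup>2 + 2 * (M * B)\<^sup>2) * Suc n" .
  qed
qed

lemma mean_digit_nonneg: "r < L \<Longrightarrow> mean_digit r \<ge> 0"
  using step_mono[of r "\<lambda>k s. 0" "\<lambda>k s. real k"] step_const[of r 0] by (simp add: mean_digit_def)

text \<open>Some nonzero digit has positive probability from state 0: the digit 1 if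
  \<open>L = 1\<close>, as then \<open>c 1 \<ge> 2\<close>, and otherwise \<open>c 1\<close>, which
  leads to state 1.\<close>

lemma mean_digit_0_pos:
  assumes "L \<noteq> 1 \<or> c 1 \<noteq> 1"
  shows "mean_digit 0 > 0"
proof (cases "L = 1")
  case True
  then have "1 \<in> {..<c 1}" using assms c1 by auto
  then have "0 < (\<Sum>k<c 1. real k)" by (intro sum_pos2[of _ 1]) auto
  moreover have "h (Suc 0) = 0" using h_L True by simp
  ultimately show ?thesis using x by (simp add: mean_digit_def step_def h_0)
next
  case False
  then have "0 < h 1 * real (c 1)" using h_pos[of 1] L c1 by auto
  moreover have "0 \<le> (\<Sum>k<c 1. real k)" by (intro sum_nonneg) auto
  ultimately show ?thesis using x by (simp add: mean_digit_def step_def h_0)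
qed

text \<open>Positivity of \<mu> follows from the minorisation applied to \<open>mean_digit\<close>.
  As \<mu> is chosen before \<open>w\<close>, different weights share the same mean.\<close>

lemma second_moment:
  assumes "L \<noteq> 1 \<or> c 1 \<noteq> 1"
  shows "\<exists>\<mu>>0. \<forall>w M. (\<forall>i. \<bar>w i\<bar> \<le> M) \<longrightarrow>
    (\<exists>A. \<forall>n. expect n 0 (\<lambda>a. (weighted_sum w a - \<mu> * (\<Sum>i<n. w (Suc i)))\<^sup>2) \<le> A * real (Suc n))"
proof -
  obtain \<mu> e B where *: "\<And>k r. r < L \<Longrightarrow> \<bar>(trans_op ^^ k) mean_digit r - \<mu>\<bar> \<le> e k"
    "\<And>n. (\<Sum>k<n. e k) \<le> B" "\<And>k. lower ((trans_op ^^ k) mean_digit) \<le> \<mu>"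
    using iterates_converge[of mean_digit] by blast
  obtain \<delta> where \<delta>: "\<delta> > 0"
    "\<And>f r. (\<And>s. s < L \<Longrightarrow> 0 \<le> f s) \<Longrightarrow> r < L \<Longrightarrow> \<delta> * f 0 \<le> (trans_op ^^ L) f r"
    using minorisation by blast
  have "\<delta> * mean_digit 0 \<le> lower ((trans_op ^^ L) mean_digit)"
    using \<delta>(2) mean_digit_nonneg by (intro lower_greatest) auto
  then have "\<delta> * mean_digit 0 \<le> \<mu>" using *(3)[of L] by linarith
  then have "\<mu> > 0"
    using mean_digit_0_pos[OF assms] \<delta>(1) by (meson less_le_trans mult_pos_pos)
  then show ?thesis
    using weighted_sum_second_moment[OF *(1,2)] by blast
qed

lemma chebyshev:
  assumes "t > 0"
  shows "expect n 0 (\<lambda>a. of_bool (t \<le> \<bar>f a\<bar>)) \<le> expect n 0 (\<lambda>a. (f a)\<^sup>2) / t\<^sup>2"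
proof -
  have "expect n 0 (\<lambda>a. of_bool (t \<le> \<bar>f a\<bar>)) \<le> expect n 0 (\<lambda>a. inverse (t\<^sup>2) * (f a)\<^sup>2)"
  proof (rule expect_mono)
    fix a :: "nat list"
    show "of_bool (t \<le> \<bar>f a\<bar>) \<le> inverse (t\<^sup>2) * (f a)\<^sup>2"
      using assms power_mono[of t "\<bar>f a\<bar>" 2] by (auto simp: field_simps)
  qed (use L in auto)
  then show ?thesis by (simp add: expect_cmult divide_inverse mult.commute)
qed

section \<open>From probabilities to numbers of words\<close>

definition words :: "nat \<Rightarrow> nat \<Rightarrow> (nat list \<Rightarrow> bool) \<Rightarrow> nat list set" where
  "words n r Q = {a. length a = n \<and> accepts L c r a \<and> Q a}"

text \<open>The factors \<open>h\<close> telescope: an accepted word leading from \<open>r\<close>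
  to \<open>s\<close> has probability \<open>x ^ n * h s / h r\<close>, and
  \<open>h s \<ge> lower h\<close>.\<close>

lemma card_words_le:
  assumes "r < L"
  shows "finite (words n r Q) \<and>
    lower h * x ^ n * card (words n r Q) \<le> h r * expect n r (\<lambda>a. of_bool (Q a))"
  using assms
proof (induction n arbitrary: r Q)
  case 0
  have "words 0 r Q = (if Q [] then {[]} else {})" by (auto simp: words_def)
  then show ?case using lower_upper[of r h] 0 by simp
next
  case (Suc n)
  define A where "A k = words n 0 (\<lambda>b. Q (k # b))" for k
  \<comment> \<open>Empty when \<open>Suc r = L\<close>, in agreement with
    \<open>h L = 0\<close>.\<close>
  define A' where "A' = (if Suc r < L then words n (Suc r) (\<lambda>b. Q (c (Suc r) # b)) else {})"
  define E where "E k s = expect n s (\<lambda>b. of_bool (Q (k # b)))" for k s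
  have L0: "0 < L" using L by simp
  have sub: "words (Suc n) r Q \<subseteq> (\<Union>k<c (Suc r). (#) k ` A k) \<union> (#) (c (Suc r)) ` A'"
  proof
    fix a assume a: "a \<in> words (Suc n) r Q"
    then obtain k b where "a = k # b" "length b = n" by (auto simp: words_def length_Suc_conv)
    then show "a \<in> (\<Union>k<c (Suc r). (#) k ` A k) \<union> (#) (c (Suc r)) ` A'"
      using a by (auto simp: words_def A_def A'_def)
  qed
  have A: "finite (A k)" "lower h * x ^ n * card (A k) \<le> E k 0" for k
    using Suc.IH[OF L0] by (auto simp: A_def E_def h_0)
  have A': "finite A' \<and> lower h * x ^ n * card A' \<le> h (Suc r) * E (c (Suc r)) (Suc r)"
  proof (cases "Suc r < L")
    case False
    then have "Suc r = L" using Suc.prems by simp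
    then show ?thesis by (simp add: A'_def h_L)
  qed (use Suc.IH in \<open>simp add: A'_def E_def\<close>)
  have fin: "finite ((\<Union>k<c (Suc r). (#) k ` A k) \<union> (#) (c (Suc r)) ` A')"
    using A A' by auto
  have "card (words (Suc n) r Q) \<le> card ((\<Union>k<c (Suc r). (#) k ` A k) \<union> (#) (c (Suc r)) ` A')"
    using sub fin by (rule card_mono[rotated])
  also have "\<dots> \<le> card (\<Union>k<c (Suc r). (#) k ` A k) + card ((#) (c (Suc r)) ` A')"
    by (rule card_Un_le)
  also have "\<dots> \<le> (\<Sum>k<c (Suc r). card ((#) k ` A k)) + card ((#) (c (Suc r)) ` A')"
    by (intro add_mono card_UN_le) auto
  also have "\<dots> \<le> (\<Sum>k<c (Suc r). card (A k)) + card A'"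
    using A A' by (intro add_mono sum_mono card_image_le) auto
  finally have card: "real (card (words (Suc n) r Q)) \<le> (\<Sum>k<c (Suc r). real (card (A k))) + real (card A')"
    by (simp flip: of_nat_sum of_nat_add)
  have "lower h \<ge> 0" using h_nonneg by (intro lower_greatest) auto
  then have "lower h * x ^ n * card (words (Suc n) r Q)
      \<le> lower h * x ^ n * ((\<Sum>k<c (Suc r). real (card (A k))) + real (card A'))"
    using x card by (intro mult_left_mono) auto
  also have "\<dots> = (\<Sum>k<c (Suc r). lower h * x ^ n * card (A k)) + lower h * x ^ n * card A'"
    by (simp add: sum_distrib_left distrib_left)
  also have "\<dots> \<le> (\<Sum>k<c (Suc r). E k 0) + h (Suc r) * E (c (Suc r)) (Suc r)"
    using A A' by (intro add_mono sum_mono) auto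
  finally have "x * (lower h * x ^ n * card (words (Suc n) r Q)) \<le> x * \<dots>"
    using x by (intro mult_left_mono) auto
  also have "\<dots> = h r * step r E" using h_pos[OF Suc.prems] by (simp add: step_def)
  finally show ?case using finite_subset[OF sub fin] by (simp add: E_def[abs_def] mult_ac)
qed

lemma lower_h_pos: "lower h > 0"
  unfolding lower_def using L h_pos by (subst Min_gr_iff) (auto simp: lessThan_empty_iff)

text \<open>The powers of \<open>1 / x\<close> solve the recurrence exactly, so a lower bound by a
  multiple of them propagates; for \<open>n < L\<close> the constant \<open>x ^ L\<close> works
  because \<open>G (n + 1) \<ge> 1\<close> and \<open>x \<le> 1\<close>.\<close>

lemma recurrence_lower_bound:
  assumes pos: "\<And>n. n \<ge> 1 \<Longrightarrow> G n > (0::nat)"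
    and rec: "\<And>n. n \<ge> L \<Longrightarrow> G (n + 1) = (\<Sum>i=1..L. c i * G (n + 1 - i))"
    and x1: "x \<le> 1"
  shows "x ^ L \<le> real (G (n + 1)) * x ^ n"
proof (induction n rule: less_induct)
  case (less n)
  show ?case
  proof (cases "n < L")
    case True
    have "x ^ L \<le> 1 * x ^ n" using True x x1 by (simp add: power_decreasing)
    also have "\<dots> \<le> real (G (n + 1)) * x ^ n"
      using pos[of "n + 1"] x by (intro mult_right_mono) (auto simp: Suc_le_eq)
    finally show ?thesis .
  next
    case False
    \<comment> \<open>By \<open>root\<close> the weights \<open>c i * x ^ i\<close> sum to 1, so
      \<open>x ^ L\<close> is their average and the hypothesis at \<open>n - i\<close> applies
      termwise.\<close>
    have "x ^ L = (\<Sum>i=1..L. real (c i) * x ^ i * x ^ L)"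
      by (simp only: sum_distrib_right[symmetric] root mult_1)
    also have "\<dots> \<le> (\<Sum>i=1..L. real (c i) * x ^ i * (real (G (n - i + 1)) * x ^ (n - i)))"
      using less False x by (intro sum_mono mult_left_mono) auto
    also have "\<dots> = (\<Sum>i=1..L. real (c i) * real (G (n + 1 - i)) * x ^ n)"
    proof (rule sum.cong[OF refl])
      fix i assume i: "i \<in> {1..L}"
      then have "x ^ n = x ^ i * x ^ (n - i)" using False by (simp flip: power_add)
      moreover have "n - i + 1 = n + 1 - i" using False i by auto
      ultimately show "real (c i) * x ^ i * (real (G (n - i + 1)) * x ^ (n - i))
          = real (c i) * real (G (n + 1 - i)) * x ^ n" by simp
    qed
    also have "\<dots> = real (G (n + 1)) * x ^ n"
      using rec[of n] False by (simp add: sum_distrib_right)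
    finally show ?thesis .
  qed
qed

end

section \<open>The root, the density and the decompositions\<close>

text \<open>Intermediate value theorem: the polynomial is 0 at 0 and at least
  \<open>c L \<ge> 1\<close> at 1.\<close>

lemma characteristic_root:
  assumes "L \<ge> 1" "c L \<ge> (1::nat)"
  obtains x :: real where "0 < x" "x \<le> 1" "(\<Sum>i=1..L. real (c i) * x ^ i) = 1"
proof -
  let ?p = "\<lambda>x::real. \<Sum>i=1..L. real (c i) * x ^ i"
  have "?p 0 = 0" by (intro sum.neutral) auto
  moreover have "real (c L) \<le> ?p 1"
    using assms member_le_sum[of L "{1..L}" "\<lambda>i. real (c i)"] by simp
  ultimately have "\<exists>x. 0 \<le> x \<and> x \<le> 1 \<and> ?p x = 1"
    using assms by (intro IVT') (auto intro!: continuous_intros)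
  then obtain x where x: "0 \<le> x" "x \<le> 1" "?p x = 1" by blast
  then have "x \<noteq> 0" using \<open>?p 0 = 0\<close> by auto
  then show ?thesis using that[of x] x by auto
qed

lemma sum_indicator_deviation:
  fixes d :: real
  shows "(\<Sum>i<n. of_bool (G (Suc i) \<in> S) - d) = real (card {i \<in> {1..n}. G i \<in> S}) - d * n"
proof -
  have "(\<Sum>i<n. of_bool (G (Suc i) \<in> S)) = (\<Sum>i\<in>{1..n}. of_bool (G i \<in> S) :: real)"
    by (rule sum.reindex_bij_witness[of _ "\<lambda>i. i - 1" Suc]) auto
  also have "\<dots> = real (card {i \<in> {1..n}. G i \<in> S})"
    by (simp add: of_bool_def sum.If_cases Int_def)
  finally show ?thesis by (simp add: sum_subtractf)
qed

lemma positive_linear_recurrence_pos: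
  "positive_linear_recurrence L c G \<Longrightarrow> n \<ge> 1 \<Longrightarrow> G n > 0"
  unfolding positive_linear_recurrence_def by blast

lemma positive_linear_recurrence_rec:
  "positive_linear_recurrence L c G \<Longrightarrow> n \<ge> L \<Longrightarrow> G (n + 1) = (\<Sum>i=1..L. c i * G (n + 1 - i))"
  unfolding positive_linear_recurrence_def by blast

lemma legal_decomposition_the_decomposition:
  assumes "positive_linear_recurrence L c G" "n \<ge> 1" "m < G (n + 1)"
  shows "legal_decomposition L c G n m (the_decomposition L c G n m)"
proof -
  have "\<exists>!a. legal_decomposition L c G n m a"
    using assms unfolding positive_linear_recurrence_def by blast
  then show ?thesis unfolding the_decomposition_def by (rule theI')
qed

section \<open>Transfer to uniform \<open>m\<close> and concentration\<close>

context digit_chain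
begin

text \<open>A decomposition determines \<open>m\<close>, so the bad \<open>m\<close> inject into the
  accepted words violating \<open>Q\<close>. The factor \<open>x ^ n\<close> cancels between
  \<open>card_words_le\<close> and \<open>recurrence_lower_bound\<close>.\<close>

lemma prob_not_within_le:
  assumes plr: "positive_linear_recurrence L c G" and x1: "x \<le> 1" and n: "n \<ge> 1"
  shows "1 - measure_pmf.prob (pmf_of_set {0..<G (n + 1)}) {m. Q (the_decomposition L c G n m)}
    \<le> expect n 0 (\<lambda>a. of_bool (\<not> Q a)) / (lower h * x ^ L)"
proof -
  define A where "A = {0..<G (n + 1)}"
  define W where "W = {m. Q (the_decomposition L c G n m)}"
  have G: "G (n + 1) > 0" using positive_linear_recurrence_pos[OF plr] by simp
  have dec: "legal_decomposition L c G n m (the_decomposition L c G n m)" if "m \<in> A" for m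
    using legal_decomposition_the_decomposition[OF plr n] that by (simp add: A_def)
  have inj: "inj_on (the_decomposition L c G n) (A - W)"
  proof (rule inj_onI)
    fix m m' assume "m \<in> A - W" "m' \<in> A - W"
      "the_decomposition L c G n m = the_decomposition L c G n m'"
    then show "m = m'" using dec[of m] dec[of m'] by (simp add: legal_decomposition_def)
  qed
  have sub: "the_decomposition L c G n ` (A - W) \<subseteq> words n 0 (\<lambda>a. \<not> Q a)"
  proof
    fix a assume "a \<in> the_decomposition L c G n ` (A - W)"
    then obtain m where m: "m \<in> A" "m \<notin> W" "a = the_decomposition L c G n m" by blast
    then have "length a = n" "legal L c a" using dec[of m] by (auto simp: legal_decomposition_def)
    then show "a \<in> words n 0 (\<lambda>a. \<not> Q a)"
      using legal_accepts[of L c a] c1 m by (simp add: words_def W_def)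
  qed
  have words: "finite (words n 0 (\<lambda>a. \<not> Q a))"
    "lower h * x ^ n * card (words n 0 (\<lambda>a. \<not> Q a)) \<le> expect n 0 (\<lambda>a. of_bool (\<not> Q a))"
    using card_words_le[of 0 n "\<lambda>a. \<not> Q a"] L h_0 by auto
  with inj sub have "card (A - W) \<le> card (words n 0 (\<lambda>a. \<not> Q a))"
    using card_inj_on_le by blast
  then have "lower h * x ^ n * card (A - W) \<le> lower h * x ^ n * card (words n 0 (\<lambda>a. \<not> Q a))"
    using lower_h_pos x by (intro mult_left_mono) auto
  also note words(2)
  finally have le: "lower h * x ^ n * card (A - W) \<le> expect n 0 (\<lambda>a. of_bool (\<not> Q a))" .
  have "lower h * x ^ L * card (A - W) \<le> lower h * (real (G (n + 1)) * x ^ n) * card (A - W)"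
    using recurrence_lower_bound[OF positive_linear_recurrence_pos[OF plr]
        positive_linear_recurrence_rec[OF plr] x1] lower_h_pos
    by (intro mult_right_mono mult_left_mono) auto
  also have "\<dots> \<le> real (G (n + 1)) * expect n 0 (\<lambda>a. of_bool (\<not> Q a))"
    using mult_left_mono[OF le, of "real (G (n + 1))"] by (simp add: mult_ac)
  finally have "card (A - W) / G (n + 1) \<le> expect n 0 (\<lambda>a. of_bool (\<not> Q a)) / (lower h * x ^ L)"
    using G lower_h_pos x by (simp add: divide_simps mult_ac)
  moreover have "1 - measure_pmf.prob (pmf_of_set A) W = card (A - W) / G (n + 1)"
  proof -
    have "card A = card (A \<inter> W) + card (A - W)"
      by (rule card_Int_Diff) (simp add: A_def)
    then show ?thesis using G by (simp add: A_def measure_pmf_of_set field_simps)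
  qed
  ultimately show ?thesis unfolding A_def W_def by simp
qed

lemma proportion_concentrates:
  assumes nontriv: "L \<noteq> 1 \<or> c 1 \<noteq> 1" and dens: "has_asymptotic_density G S d" and \<epsilon>: "\<epsilon> > 0"
  shows "(\<lambda>n. expect n 0 (\<lambda>a. of_bool (\<not> proportion_within G S d \<epsilon> a))) \<longlonglongrightarrow> 0"
proof -
  define w where "w j = of_bool (G j \<in> S) - d" for j
  obtain \<mu> where \<mu>: "\<mu> > 0" and moment: "\<And>w M. \<forall>i. \<bar>w i\<bar> \<le> M \<Longrightarrow>
      \<exists>A. \<forall>n. expect n 0 (\<lambda>a. (weighted_sum w a - \<mu> * (\<Sum>i<n. w (Suc i)))\<^sup>2) \<le> A * real (Suc n)"
    using second_moment[OF nontriv] by blast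
  obtain A1 where A1: "\<And>n. expect n 0 (\<lambda>a. (weighted_sum (\<lambda>_. 1) a - \<mu> * n)\<^sup>2) \<le> A1 * real (Suc n)"
    using moment[of "\<lambda>_. 1" 1] by auto
  have w_bound: "\<forall>i. \<bar>w i\<bar> \<le> 1 + \<bar>d\<bar>" by (auto simp: w_def of_bool_def)
  obtain A2 where
    A2: "\<And>n. expect n 0 (\<lambda>a. (weighted_sum w a - \<mu> * (\<Sum>i<n. w (Suc i)))\<^sup>2) \<le> A2 * real (Suc n)"
    using moment[OF w_bound] by blast
  \<comment> \<open>A bad word with more than \<open>\<mu> / 2 * n\<close> summands has
    \<open>\<bar>weighted_sum w a\<bar>\<close> above \<open>\<epsilon> * \<mu> / 2 * n\<close>. For
    large \<open>n\<close> the density lets the centring term take at most half of this, leaving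
    \<open>\<epsilon> * \<mu> / 4 * n\<close> as Chebyshev threshold.\<close>
  define bound where
    "bound n = A1 * Suc n / (\<mu> / 2 * n)\<^sup>2 + A2 * Suc n / (\<epsilon> * \<mu> / 4 * n)\<^sup>2" for n
  have "(\<lambda>n. inverse (real n) + inverse (real n) * inverse (real n)) \<longlonglongrightarrow> 0"
    by (intro tendsto_add_zero tendsto_mult_zero lim_inverse_n)
  also have "(\<lambda>n. inverse (real n) + inverse (real n) * inverse (real n))
      = (\<lambda>n. real (Suc n) / (real n)\<^sup>2)"
  proof
    fix n
    show "inverse (real n) + inverse (real n) * inverse (real n) = real (Suc n) / (real n)\<^sup>2"
      \<comment> \<open>At \<open>n = 0\<close> both sides are 0, as division by 0 gives 0.\<close>
      by (cases "n = 0") (auto simp: field_simps power2_eq_square)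
  qed
  finally have "(\<lambda>n. A1 / (\<mu> / 2)\<^sup>2 * (real (Suc n) / (real n)\<^sup>2)
      + A2 / (\<epsilon> * \<mu> / 4)\<^sup>2 * (real (Suc n) / (real n)\<^sup>2)) \<longlonglongrightarrow> 0"
    by (intro tendsto_add_zero tendsto_mult_right_zero)
  then have lim: "bound \<longlonglongrightarrow> 0"
    unfolding bound_def[abs_def] by (simp only: power_mult_distrib times_divide_times_eq)
  have le: "eventually
    (\<lambda>n. expect n 0 (\<lambda>a. of_bool (\<not> proportion_within G S d \<epsilon> a)) \<le> bound n) sequentially"
  proof -
    have "eventually (\<lambda>n. \<bar>real (card {i \<in> {1..n}. G i \<in> S}) / real n - d\<bar> < \<epsilon> / 4) sequentially"
      using dens \<epsilon> tendstoD[of _ d sequentially "\<epsilon> / 4"]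
      by (simp add: has_asymptotic_density_def dist_real_def)
    then show ?thesis
      using eventually_ge_at_top[of 1]
    proof eventually_elim
      case (elim n)
      then have n: "real n > 0" by simp
      have "(\<Sum>i<n. w (Suc i)) = (real (card {i \<in> {1..n}. G i \<in> S}) / real n - d) * n"
        unfolding w_def sum_indicator_deviation using n by (simp add: left_diff_distrib)
      then have "\<bar>\<Sum>i<n. w (Suc i)\<bar> = \<bar>real (card {i \<in> {1..n}. G i \<in> S}) / real n - d\<bar> * n"
        by (simp add: abs_mult)
      also have "\<dots> \<le> \<epsilon> / 4 * n" using elim n by (intro mult_right_mono) auto
      finally have "\<mu> * \<bar>\<Sum>i<n. w (Suc i)\<bar> \<le> \<mu> * (\<epsilon> / 4 * n)"
        using \<mu> by (intro mult_left_mono) auto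
      then have dev: "\<bar>\<mu> * (\<Sum>i<n. w (Suc i))\<bar> \<le> \<epsilon> * \<mu> / 4 * n"
        using \<mu> by (simp add: abs_mult mult_ac)
      have "expect n 0 (\<lambda>a. of_bool (\<not> proportion_within G S d \<epsilon> a))
          \<le> expect n 0 (\<lambda>a. of_bool (\<mu> / 2 * n \<le> \<bar>weighted_sum (\<lambda>_. 1) a - \<mu> * n\<bar>)
            + of_bool (\<epsilon> * \<mu> / 4 * n \<le> \<bar>weighted_sum w a - \<mu> * (\<Sum>i<n. w (Suc i))\<bar>))"
      proof (rule expect_mono)
        fix a :: "nat list"
        define N where "N = real (num_summands a)"
        have "\<mu> / 2 * n \<le> \<bar>N - \<mu> * n\<bar>
            \<or> \<epsilon> * \<mu> / 4 * n \<le> \<bar>weighted_sum w a - \<mu> * (\<Sum>i<n. w (Suc i))\<bar>"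
          if "\<not> proportion_within G S d \<epsilon> a"
        proof (rule disjCI)
          assume small: "\<not> \<epsilon> * \<mu> / 4 * n \<le> \<bar>weighted_sum w a - \<mu> * (\<Sum>i<n. w (Suc i))\<bar>"
          have N: "N > 0" using that by (simp add: N_def proportion_within_def)
          have "\<epsilon> \<le> \<bar>real (num_summands_in G S a) / N - d\<bar>"
            using that by (simp add: N_def proportion_within_def proportion_in_def)
          then have "\<epsilon> * N \<le> \<bar>real (num_summands_in G S a) / N - d\<bar> * N"
            using N by (intro mult_right_mono) auto
          also have "\<dots> = \<bar>weighted_sum w a\<bar>"
          proof -
            have "weighted_sum w a = (real (num_summands_in G S a) / N - d) * N"
              unfolding w_def weighted_sum_indicator using N by (simp add: N_def left_diff_distrib)
            then show ?thesis using N by (simp add: abs_mult)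
          qed
          also have "\<dots> \<le> \<epsilon> * (\<mu> / 2 * n)" 
            using small dev
              abs_triangle_ineq[of "weighted_sum w a - \<mu> * (\<Sum>i<n. w (Suc i))" "\<mu> * (\<Sum>i<n. w (Suc i))"]
            by (simp add: algebra_simps)
          finally have "N \<le> \<mu> / 2 * n" using \<epsilon> by simp
          then show "\<mu> / 2 * n \<le> \<bar>N - \<mu> * n\<bar>" by linarith
        qed
        then show "(of_bool (\<not> proportion_within G S d \<epsilon> a) :: real)
          \<le> of_bool (\<mu> / 2 * n \<le> \<bar>weighted_sum (\<lambda>_. 1) a - \<mu> * n\<bar>)
            + of_bool (\<epsilon> * \<mu> / 4 * n \<le> \<bar>weighted_sum w a - \<mu> * (\<Sum>i<n. w (Suc i))\<bar>)"
          unfolding weighted_sum_one N_def by auto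
      qed (use L in simp)
      also have "\<dots> \<le> bound n"
        unfolding expect_add bound_def
      proof (rule add_mono)
        show "expect n 0 (\<lambda>a. of_bool (\<mu> / 2 * n \<le> \<bar>weighted_sum (\<lambda>_. 1) a - \<mu> * n\<bar>))
            \<le> A1 * Suc n / (\<mu> / 2 * n)\<^sup>2"
          by (rule order_trans[OF chebyshev divide_right_mono[OF A1]]) (use \<mu> n in auto)
        show "expect n 0 (\<lambda>a. of_bool (\<epsilon> * \<mu> / 4 * n \<le> \<bar>weighted_sum w a - \<mu> * (\<Sum>i<n. w (Suc i))\<bar>))
            \<le> A2 * Suc n / (\<epsilon> * \<mu> / 4 * n)\<^sup>2"
          by (rule order_trans[OF chebyshev divide_right_mono[OF A2]]) (use \<mu> \<epsilon> n in auto)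
      qed
      finally show ?case .
    qed
  qed
  have "0 \<le> expect n 0 (\<lambda>a. of_bool (\<not> proportion_within G S d \<epsilon> a))" for n
    using expect_mono[of 0 n "\<lambda>_. 0" "\<lambda>a. of_bool (\<not> proportion_within G S d \<epsilon> a)"]
      expect_const[of 0 n 0] L by simp
  then show ?thesis
    by (intro tendsto_sandwich[OF _ le tendsto_const lim] always_eventually allI)
qed

end

section \<open>The trivial recurrence and the limit\<close>

text \<open>For \<open>L = 1\<close> a digit can never equal \<open>c 1\<close>, so it lies below
  1.\<close>

lemma accepts_trivial_recurrence: "c 1 = 1 \<Longrightarrow> accepts 1 c 0 a \<Longrightarrow> set a \<subseteq> {0}"
  by (induction a) auto

theorem theorem1p1:
  fixes L :: nat and c G :: "nat \<Rightarrow> nat" and S :: "nat set" and d \<epsilon> :: real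
  assumes "L \<ge> 1" and "c 1 \<ge> 1" and "c L \<ge> 1"
    and "positive_linear_recurrence L c G"
    and "S \<subseteq> G ` {1..}"
    and "has_asymptotic_density G S d" and "d > 0"
    and "\<epsilon> > 0"
  shows "(\<lambda>n. measure_pmf.prob (pmf_of_set {0..<G (n + 1)})
            {m. proportion_within G S d \<epsilon> (the_decomposition L c G n m)}) \<longlonglongrightarrow> 1"
proof -
  obtain x :: real where root: "0 < x" "x \<le> 1" "(\<Sum>i=1..L. real (c i) * x ^ i) = 1"
    using characteristic_root assms(1,3) by blast
  interpret digit_chain L c x
    using assms root by unfold_locales auto
  define p where "p n = measure_pmf.prob (pmf_of_set {0..<G (n + 1)})
    {m. proportion_within G S d \<epsilon> (the_decomposition L c G n m)}" for n
  have "p \<longlonglongrightarrow> 1"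
  \<comment> \<open>Concentration rests on a positive mean digit; in the excluded case there are no
    summands and \<open>proportion_within\<close> holds by its convention.\<close>
  proof (cases "L = 1 \<and> c 1 = 1")
    case True
    have "p n = 1" if n: "n \<ge> 1" for n
    proof -
      have G: "G (n + 1) > 0" using positive_linear_recurrence_pos[OF assms(4)] by simp
      have "proportion_within G S d \<epsilon> (the_decomposition L c G n m)" if "m < G (n + 1)" for m
      proof -
        let ?a = "the_decomposition L c G n m"
        have "legal_decomposition L c G n m ?a"
          using legal_decomposition_the_decomposition[OF assms(4) n that] .
        then have "accepts L c 0 ?a"
          using legal_accepts[of L c ?a] assms(2) by (simp add: legal_decomposition_def)
        then have "set ?a \<subseteq> {0}"
          using True accepts_trivial_recurrence[of c ?a] by simp
        then have "?a ! i = 0" if "i < length ?a" for i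
          using nth_mem[OF that] by auto
        then have "num_summands ?a = 0"
          unfolding num_summands_def by (intro sum.neutral) auto
        then show ?thesis by (simp add: proportion_within_def)
      qed
      then have "{0..<G (n + 1)} \<inter> {m. proportion_within G S d \<epsilon> (the_decomposition L c G n m)}
          = {0..<G (n + 1)}" by auto
      then show ?thesis using G by (simp add: p_def measure_pmf_of_set)
    qed
    then show ?thesis
      by (intro tendsto_eventually eventually_sequentiallyI[of 1]) auto
  next
    case False
    let ?E = "\<lambda>n. expect n 0 (\<lambda>a. of_bool (\<not> proportion_within G S d \<epsilon> a)) / (lower h * x ^ L)"
    have lim: "(\<lambda>n. 1 - ?E n) \<longlonglongrightarrow> 1"
      using tendsto_diff[OF tendsto_const
          tendsto_divide_zero[OF proportion_concentrates[OF _ assms(6,8)]], of 1]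
        False by simp
    have ge: "eventually (\<lambda>n. 1 - ?E n \<le> p n) sequentially"
    proof (rule eventually_sequentiallyI[of 1])
      fix n :: nat assume "1 \<le> n"
      then show "1 - ?E n \<le> p n"
        using prob_not_within_le[OF assms(4) \<open>x \<le> 1\<close>, of n "proportion_within G S d \<epsilon>"]
        unfolding p_def by linarith
    qed
    have "eventually (\<lambda>n. p n \<le> 1) sequentially"
      by (simp add: p_def)
    then show ?thesis
      by (rule tendsto_sandwich[OF ge _ lim tendsto_const])
  qed
  then show ?thesis unfolding p_def[abs_def] .
qed

end
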